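(* Let $L$ be a lattice of rank $2$ and let $\sigma\subset L_{\mathbf{R}}$ be a closed strictly convex 2-dimensional cone with ordered edges $l_-,l_+$. Let $\sigma'$ be the supplementary cone of $\sigma$ bounded by $l_+$ and by the half-line opposite to $l_-$. Let $\omega$ be the volume form on $L_{\mathbf{R}}$ such that $\omega(u_1,u_2)=1$ for any basis $(u_1,u_2)$ of $L$ defining the orientation opposite to that of $(l_-,l_+)$, viewed as the morphism $\omega:L\to\check{L}$, $u\mapsto\omega(u,\cdot)$. Then $\omega$ realizes an isomorphism between the pairs $(L,\sigma')$ and $(\check{L},\check{\sigma})$; that is, $\omega:L\to\check{L}$ is an isomorphism of lattices whose real extension maps $\sigma'$ onto $\check{\sigma}$.
   Context: $L$ is a free abelian group of rank 2, $L_{\mathbf{R}}=L\otimes_{\mathbf{Z}}\mathbf{R}$. $\check{L}=\mathrm{Hom}(L,\mathbf{Z})$ is the dual lattice, and $\check{\sigma}=\{\check{u}\in\check{L}_{\mathbf{R}} \mid \check{u}\cdot u\ge0\ \ \forall u\in\sigma\}$ is the dual cone. A closed strictly convex 2-dimensional cone is the convex angle delimited by two distinct non-opposite half-lines from the origin, called its edges. The edges are not assumed rational. The orientation defined by $(l_-,l_+)$ is the one of any basis $(v_-,v_+)$ of $L_{\mathbf{R}}$ with $v_\pm\in l_\pm$. *)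

theory Defs
  imports "HOL-Analysis.Analysis"
begin

definition real_basis :: "'v::real_vector \<Rightarrow> 'v \<Rightarrow> bool" where
  "real_basis v w \<longleftrightarrow> v \<noteq> w \<and> independent {v, w} \<and> span {v, w} = UNIV"

(* A lattice L of rank 2 is given together with its embedding in L_R: the type 'v plays the
   role of the tensor product of L with the reals, i.e. some Z-basis of L is an R-basis of 'v
   (and then every Z-basis is one). *)
definition lattice_basis :: "'v::real_vector set \<Rightarrow> 'v \<Rightarrow> 'v \<Rightarrow> bool" where
  "lattice_basis L u1 u2 \<longleftrightarrow>
     real_basis u1 u2 \<and> L = {of_int m *\<^sub>R u1 + of_int n *\<^sub>R u2 | m n. True}"

definition rank2_lattice :: "'v::real_vector set \<Rightarrow> bool" where
  "rank2_lattice L \<longleftrightarrow> (\<exists>u1 u2. lattice_basis L u1 u2)"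

typedef (overloaded) 'v linear_dual = "{f :: 'v::real_vector \<Rightarrow> real. linear f}"
  morphisms pairing Functional
  by (rule exI[of _ "\<lambda>_. 0"]) (simp add: linear_iff)

setup_lifting type_definition_linear_dual

instantiation linear_dual :: (real_vector) real_vector
begin

lift_definition zero_linear_dual :: "'a linear_dual" is "\<lambda>_. 0"
  by (simp add: linear_iff)

lift_definition plus_linear_dual :: "'a linear_dual \<Rightarrow> 'a linear_dual \<Rightarrow> 'a linear_dual"
  is "\<lambda>f g x. f x + g x"
  by (simp add: linear_iff algebra_simps)

lift_definition minus_linear_dual :: "'a linear_dual \<Rightarrow> 'a linear_dual \<Rightarrow> 'a linear_dual"
  is "\<lambda>f g x. f x - g x"
  by (simp add: linear_iff algebra_simps)

lift_definition uminus_linear_dual :: "'a linear_dual \<Rightarrow> 'a linear_dual"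
  is "\<lambda>f x. - f x"
  by (simp add: linear_iff algebra_simps)

lift_definition scaleR_linear_dual :: "real \<Rightarrow> 'a linear_dual \<Rightarrow> 'a linear_dual"
  is "\<lambda>c f x. c * f x"
  by (simp add: linear_iff algebra_simps)

instance
  by standard (transfer; simp add: fun_eq_iff algebra_simps)+

end

(* Hom(L, Z), embedded in the real dual space by R-linear extension. The two lemmas after this
   definition justify the identification: restriction to L is a bijection onto the additive maps
   from L to the integers, and the dual space is the scalar extension of this lattice. *)
definition dual_lattice :: "'v::real_vector set \<Rightarrow> 'v linear_dual set" where
  "dual_lattice L = {f. \<forall>u\<in>L. pairing f u \<in> \<int>}"

lemma linear_pairing: "linear (pairing f)"
  using pairing[of f] by simp

lemma pairing_Functional: "linear f \<Longrightarrow> pairing (Functional f) = f"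
  by (simp add: Functional_inverse)

lemma real_basis_repr:
  assumes "real_basis v w"
  obtains a b where "x = a *\<^sub>R v + b *\<^sub>R w"
proof -
  have "x \<in> span {v, w}" using assms by (simp add: real_basis_def)
  then obtain a where "x - a *\<^sub>R v \<in> span {w}" by (auto simp: span_insert)
  then obtain b where "x - a *\<^sub>R v = b *\<^sub>R w" by (auto simp: span_singleton)
  then have "x = a *\<^sub>R v + b *\<^sub>R w" by (simp add: algebra_simps)
  then show thesis by (rule that)
qed

lemma real_basis_functional:
  assumes "real_basis v w"
  obtains f where "pairing f v = a" "pairing f w = b"
proof -
  obtain g where "linear g" "\<forall>x\<in>{v, w}. g x = (if x = v then a else b)"
    using linear_independent_extend[of "{v, w}" "\<lambda>x. if x = v then a else b"] assms
    by (auto simp: real_basis_def)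
  then show thesis
    using that[of "Functional g"] assms by (auto simp: pairing_Functional real_basis_def)
qed

lemma real_basis_functional_eqI:
  assumes "real_basis v w" "pairing f v = pairing g v" "pairing f w = pairing g w"
  shows "f = g"
proof -
  have "pairing f x = pairing g x" for x
  proof -
    obtain a b where "x = a *\<^sub>R v + b *\<^sub>R w" using real_basis_repr[OF assms(1)] .
    then show ?thesis using assms(2,3)
      by (simp add: linear_add[OF linear_pairing] linear_scale[OF linear_pairing])
  qed
  then show ?thesis by (metis ext pairing_inject)
qed

lemma dual_lattice_restrict_bij:
  assumes "rank2_lattice L"
  shows "bij_betw (\<lambda>f. restrict (\<lambda>u. \<lfloor>pairing f u\<rfloor>) L) (dual_lattice L)
           {h :: 'v::real_vector \<Rightarrow> int. h \<in> extensional L \<and> (\<forall>u\<in>L. \<forall>v\<in>L. h (u + v) = h u + h v)}"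
    (is "bij_betw ?r _ ?H")
proof -
  obtain u1 u2 where B: "real_basis u1 u2"
    and L: "L = {of_int m *\<^sub>R u1 + of_int n *\<^sub>R u2 | m n. True}"
    using assms by (auto simp: rank2_lattice_def lattice_basis_def)
  have in_L: "of_int m *\<^sub>R u1 + of_int n *\<^sub>R u2 \<in> L" for m n unfolding L by blast
  have u: "u1 \<in> L" "u2 \<in> L" "0 \<in> L"
    using in_L[of 1 0] in_L[of 0 1] in_L[of 0 0] by simp_all
  have L_add: "x + y \<in> L" if "x \<in> L" "y \<in> L" for x y
  proof -
    obtain m n k l where "x = of_int m *\<^sub>R u1 + of_int n *\<^sub>R u2" "y = of_int k *\<^sub>R u1 + of_int l *\<^sub>R u2"
      using \<open>x \<in> L\<close> \<open>y \<in> L\<close> unfolding L by blast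
    then have "x + y = of_int (m + k) *\<^sub>R u1 + of_int (n + l) *\<^sub>R u2" by (simp add: algebra_simps)
    then show ?thesis using in_L by metis
  qed
  have L_minus: "- x \<in> L" if "x \<in> L" for x
  proof -
    obtain m n where "x = of_int m *\<^sub>R u1 + of_int n *\<^sub>R u2"
      using \<open>x \<in> L\<close> unfolding L by blast
    then have "- x = of_int (- m) *\<^sub>R u1 + of_int (- n) *\<^sub>R u2" by (simp add: algebra_simps)
    then show ?thesis using in_L by metis
  qed
  have floor_val: "of_int \<lfloor>pairing f x\<rfloor> = pairing f x" if "f \<in> dual_lattice L" "x \<in> L" for f x
    using that by (auto simp: dual_lattice_def)
  show ?thesis
  proof (rule bij_betwI')
    fix f g assume f: "f \<in> dual_lattice L" and g: "g \<in> dual_lattice L"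
    show "(?r f = ?r g) = (f = g)"
    proof
      assume "?r f = ?r g"
      then have "?r f x = ?r g x" for x by simp
      then have "pairing f x = pairing g x" if "x \<in> L" for x
        using floor_val[OF f that] floor_val[OF g that] that by (metis restrict_apply')
      then show "f = g" using real_basis_functional_eqI[OF B] u by blast
    qed simp
  next
    fix f assume f: "f \<in> dual_lattice L"
    have "\<lfloor>pairing f (x + y)\<rfloor> = \<lfloor>pairing f x\<rfloor> + \<lfloor>pairing f y\<rfloor>" if "x \<in> L" "y \<in> L" for x y
      using floor_val[OF f that(1)] floor_val[OF f that(2)]
      by (metis floor_of_int linear_add linear_pairing of_int_add)
    then show "?r f \<in> ?H" by (auto simp: L_add)
  next
    fix h assume "h \<in> ?H"
    then have ext: "h \<in> extensional L"
      and add: "\<And>x y. x \<in> L \<Longrightarrow> y \<in> L \<Longrightarrow> h (x + y) = h x + h y" by auto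
    have h0: "h 0 = 0" using add[OF u(3) u(3)] by simp
    have hminus: "h (- x) = - h x" if "x \<in> L" for x
      using add[OF that L_minus[OF that]] h0 by simp
    have multn: "of_nat k *\<^sub>R x \<in> L \<and> h (of_nat k *\<^sub>R x) = of_nat k * h x" if "x \<in> L" for k x
      by (induction k) (simp_all add: h0 u that L_add add algebra_simps)
    have mult: "of_int m *\<^sub>R x \<in> L \<and> h (of_int m *\<^sub>R x) = m * h x" if "x \<in> L" for m x
    proof (cases "m \<ge> 0")
      case True
      then show ?thesis using multn[OF that, of "nat m"] by simp
    next
      case False
      then have eq: "of_int m *\<^sub>R x = - (of_nat (nat (- m)) *\<^sub>R x)" by simp
      from False have "int (nat (- m)) * h x = - (m * h x)" by simp
      then show ?thesis
        unfolding eq using multn[OF that, of "nat (- m)"] L_minus hminus by simp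
    qed
    obtain f where f: "pairing f u1 = of_int (h u1)" "pairing f u2 = of_int (h u2)"
      using real_basis_functional[OF B] .
    have val: "pairing f x = of_int (h x)" if "x \<in> L" for x
    proof -
      obtain m n where x: "x = of_int m *\<^sub>R u1 + of_int n *\<^sub>R u2"
        using \<open>x \<in> L\<close> unfolding L by blast
      have "h x = m * h u1 + n * h u2" unfolding x using mult u add by simp
      then show ?thesis unfolding x
        by (simp add: f linear_add[OF linear_pairing] linear_scale[OF linear_pairing])
    qed
    have "h = ?r f" using ext by (auto simp: fun_eq_iff val extensional_def)
    moreover have "f \<in> dual_lattice L" by (simp add: dual_lattice_def val)
    ultimately show "\<exists>f\<in>dual_lattice L. h = ?r f" by blast
  qed
qed

lemma rank2_lattice_dual_lattice:
  fixes L :: "'v::real_vector set"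
  assumes "rank2_lattice L"
  shows "rank2_lattice (dual_lattice L)"
proof -
  obtain u1 u2 where B: "real_basis u1 u2"
    and L: "L = {of_int m *\<^sub>R u1 + of_int n *\<^sub>R u2 | m n. True}"
    using assms by (auto simp: rank2_lattice_def lattice_basis_def)
  obtain f where f: "pairing f u1 = 1" "pairing f u2 = 0" using real_basis_functional[OF B] .
  obtain g where g: "pairing g u1 = 0" "pairing g u2 = 1" using real_basis_functional[OF B] .
  have val: "pairing (a *\<^sub>R f + b *\<^sub>R g) x = a * pairing f x + b * pairing g x" for a b x
    by (simp add: plus_linear_dual.rep_eq scaleR_linear_dual.rep_eq)
  have repr: "h = pairing h u1 *\<^sub>R f + pairing h u2 *\<^sub>R g" for h
    by (rule real_basis_functional_eqI[OF B]) (simp_all add: val f g)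
  have "f \<noteq> g" using f g by auto
  moreover have "f \<noteq> 0" using f by (auto simp: zero_linear_dual.rep_eq)
  moreover have "g \<noteq> c *\<^sub>R f" for c
  proof
    assume "g = c *\<^sub>R f"
    then have "pairing g u2 = c * pairing f u2" by (simp add: scaleR_linear_dual.rep_eq)
    then show False using f g by simp
  qed
  ultimately have "independent {g, f}" by (auto simp: independent_insert span_singleton)
  moreover have "span {f, g} = UNIV"
  proof -
    have "h \<in> span {f, g}" for h
      by (subst repr[of h]) (intro span_add span_scale span_base; simp)
    then show ?thesis by auto
  qed
  ultimately have "real_basis f g"
    using \<open>f \<noteq> g\<close> by (simp add: real_basis_def insert_commute)
  moreover have "dual_lattice L = {of_int m *\<^sub>R f + of_int n *\<^sub>R g | m n. True}"
  proof (intro set_eqI iffI)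
    fix h assume h: "h \<in> dual_lattice L"
    have "of_int 1 *\<^sub>R u1 + of_int 0 *\<^sub>R u2 \<in> L" "of_int 0 *\<^sub>R u1 + of_int 1 *\<^sub>R u2 \<in> L"
      unfolding L by blast+
    then have "pairing h u1 \<in> \<int>" "pairing h u2 \<in> \<int>" using h by (auto simp: dual_lattice_def)
    then obtain m n where "pairing h u1 = of_int m" "pairing h u2 = of_int n"
      by (metis Ints_cases)
    then have "h = of_int m *\<^sub>R f + of_int n *\<^sub>R g" using repr[of h] by simp
    then show "h \<in> {of_int m *\<^sub>R f + of_int n *\<^sub>R g | m n. True}" by blast
  next
    fix h assume "h \<in> {of_int m *\<^sub>R f + of_int n *\<^sub>R g | m n. True}"
    then show "h \<in> dual_lattice L"
      unfolding dual_lattice_def L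
      by (auto simp: val linear_add[OF linear_pairing] linear_scale[OF linear_pairing] f g)
  qed
  ultimately show ?thesis by (auto simp: rank2_lattice_def lattice_basis_def)
qed

definition dual_cone :: "'v::real_vector set \<Rightarrow> 'v linear_dual set" where
  "dual_cone \<sigma> = {f. \<forall>u\<in>\<sigma>. pairing f u \<ge> 0}"

definition half_line :: "'v::real_vector set \<Rightarrow> bool" where
  "half_line l \<longleftrightarrow> (\<exists>v. v \<noteq> 0 \<and> l = {t *\<^sub>R v | t. t \<ge> 0})"

definition convex_angle :: "'v::real_vector set \<Rightarrow> 'v set \<Rightarrow> 'v set" where
  "convex_angle l m = convex hull (l \<union> m)"

definition cone_with_edges :: "'v::real_vector set \<Rightarrow> 'v set \<Rightarrow> 'v set \<Rightarrow> bool" where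
  "cone_with_edges \<sigma> l m \<longleftrightarrow>
     half_line l \<and> half_line m \<and> l \<noteq> m \<and> l \<noteq> uminus ` m \<and> \<sigma> = convex_angle l m"

definition supplementary_cone :: "'v::real_vector set \<Rightarrow> 'v set \<Rightarrow> 'v set" where
  "supplementary_cone l_minus l_plus = convex_angle l_plus (uminus ` l_minus)"

definition opposite_orientation :: "'v::real_vector \<Rightarrow> 'v \<Rightarrow> 'v \<Rightarrow> 'v \<Rightarrow> bool" where
  "opposite_orientation v1 v2 w1 w2 \<longleftrightarrow> real_basis v1 v2 \<and> real_basis w1 w2 \<and>
     (\<exists>a b c d. w1 = a *\<^sub>R v1 + b *\<^sub>R v2 \<and> w2 = c *\<^sub>R v1 + d *\<^sub>R v2 \<and> a * d - b * c < 0)"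

(* Any choice of a basis (v1, v2) with v1 in l and v2 in m gives the same condition. *)
definition opposite_to_edges :: "'v::real_vector set \<Rightarrow> 'v set \<Rightarrow> 'v \<Rightarrow> 'v \<Rightarrow> bool" where
  "opposite_to_edges l m u1 u2 \<longleftrightarrow> (\<exists>v1\<in>l. \<exists>v2\<in>m. opposite_orientation v1 v2 u1 u2)"

definition volume_form :: "('v::real_vector \<Rightarrow> 'v \<Rightarrow> real) \<Rightarrow> bool" where
  "volume_form \<omega> \<longleftrightarrow> bilinear \<omega> \<and> (\<forall>u. \<omega> u u = 0) \<and> (\<exists>u v. \<omega> u v \<noteq> 0)"

(* The R-linear extension of u \<mapsto> \<omega>(u, _) to the ambient real vector space. *)
definition form_morphism :: "('v::real_vector \<Rightarrow> 'v \<Rightarrow> real) \<Rightarrow> 'v \<Rightarrow> 'v linear_dual" where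
  "form_morphism \<omega> u = Functional (\<omega> u)"

(* An R-linear map restricting to a bijection of the lattices restricts to a group isomorphism
   and is the unique real extension of that restriction. *)
definition pair_iso ::
  "('v::real_vector \<Rightarrow> 'w::real_vector) \<Rightarrow> 'v set \<times> 'v set \<Rightarrow> 'w set \<times> 'w set \<Rightarrow> bool" where
  "pair_iso \<phi> P Q \<longleftrightarrow>
     linear \<phi> \<and> bij_betw \<phi> (fst P) (fst Q) \<and> \<phi> ` snd P = snd Q"

end

(* For generators v and w of the edges, opposite orientation makes omega(w, v) positive. Then
   omega(s w - t v, _) takes the values s omega(w, v) on v and t omega(w, v) on w, so its signs on
   the two edges are those of s and t: this is the statement on cones. The statement on lattices
   is unimodularity, omega(u1, u2) = 1. *)
theory Submission imports Defs begin

section \<open>Bases of the real plane and determinants\<close>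

lemma real_basis_commute: "real_basis v w \<longleftrightarrow> real_basis w v"
  by (auto simp: real_basis_def insert_commute)

text \<open>Swapping reverses orientation, so this serves to give a lattice basis whichever
  orientation is wanted.\<close>

lemma lattice_basis_commute: "lattice_basis L u1 u2 \<Longrightarrow> lattice_basis L u2 u1"
  unfolding lattice_basis_def
  by (subst real_basis_commute) (simp, metis add.commute)

text \<open>Cramer's rule: the coefficients are the entries of the inverse of the matrix with rows
  \<open>(a, b)\<close> and \<open>(c, d)\<close>.\<close>

lemma real_basis_solve:
  fixes v w :: "'v::real_vector"
  assumes v: "v = a *\<^sub>R u1 + b *\<^sub>R u2" and w: "w = c *\<^sub>R u1 + d *\<^sub>R u2"
    and D: "a * d - b * c \<noteq> (0::real)"
  shows "u1 = (d / (a * d - b * c)) *\<^sub>R v + (- b / (a * d - b * c)) *\<^sub>R w"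
    and "u2 = (- c / (a * d - b * c)) *\<^sub>R v + (a / (a * d - b * c)) *\<^sub>R w"
proof -
  define D where "D = a * d - b * c"
  have [simp]: "D \<noteq> 0" using D by (simp add: D_def)
  have "(d / D) *\<^sub>R v + (- b / D) *\<^sub>R w
      = (d / D * a + - b / D * c) *\<^sub>R u1 + (d / D * b + - b / D * d) *\<^sub>R u2"
    unfolding v w by (simp only: scaleR_add_left scaleR_add_right scaleR_scaleR ac_simps)
  moreover have "d / D * a + - b / D * c = 1" "d / D * b + - b / D * d = 0"
    using D by (simp_all add: D_def divide_simps)
  ultimately show "u1 = (d / (a * d - b * c)) *\<^sub>R v + (- b / (a * d - b * c)) *\<^sub>R w"
    by (simp flip: D_def)
  have "(- c / D) *\<^sub>R v + (a / D) *\<^sub>R w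
      = (- c / D * a + a / D * c) *\<^sub>R u1 + (- c / D * b + a / D * d) *\<^sub>R u2"
    unfolding v w by (simp only: scaleR_add_left scaleR_add_right scaleR_scaleR ac_simps)
  moreover have "- c / D * b + a / D * d = 1" "- c / D * a + a / D * c = 0"
    using D by (simp_all add: D_def divide_simps)
  ultimately show "u2 = (- c / (a * d - b * c)) *\<^sub>R v + (a / (a * d - b * c)) *\<^sub>R w"
    by (simp flip: D_def)
qed

lemma real_basis_transform:
  assumes B: "real_basis u1 u2"
    and v: "v = a *\<^sub>R u1 + b *\<^sub>R u2" and w: "w = c *\<^sub>R u1 + d *\<^sub>R u2"
    and D: "a * d - b * c \<noteq> 0"
  shows "real_basis v w"
proof -
  have "x *\<^sub>R v + y *\<^sub>R w \<in> span {v, w}" for x y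
    by (intro span_add span_scale span_base) auto
  \<comment> \<open>With the coefficients of Cramer's rule these combinations are \<open>u1\<close>
    and \<open>u2\<close>, so the span contains a basis.\<close>
  from this[of "d / (a * d - b * c)" "- b / (a * d - b * c)"]
    this[of "- c / (a * d - b * c)" "a / (a * d - b * c)"]
  have "{u1, u2} \<subseteq> span {v, w}"
    by (simp only: real_basis_solve[OF v w D, symmetric]) simp
  then have "span {v, w} = UNIV"
    using B span_minimal[OF _ subspace_span, of "{u1, u2}" "{v, w}"]
    unfolding real_basis_def by blast
  \<comment> \<open>In coordinates, \<open>g\<close> is the determinant with first row
    \<open>v\<close>: it vanishes at \<open>v\<close> and equals \<open>a * d - b * c\<close> at
    \<open>w\<close>, so \<open>w\<close> is no multiple of \<open>v\<close>. Likewise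
    \<open>h\<close> is the determinant with first row \<open>w\<close> up to sign, and its value at
    \<open>v\<close> is the nonzero number \<open>b * c - a * d\<close>.\<close>
  moreover obtain g where g: "pairing g u1 = - b" "pairing g u2 = a"
    using real_basis_functional[OF B] .
  obtain h where h: "pairing h u1 = - d" "pairing h u2 = c"
    using real_basis_functional[OF B] .
  note lin = linear_add[OF linear_pairing] linear_scale[OF linear_pairing]
    linear_0[OF linear_pairing]
  have ndep: "w \<noteq> k *\<^sub>R v" for k
  proof
    assume "w = k *\<^sub>R v"
    then have "pairing g w = k * pairing g v" by (simp add: lin)
    with D show False by (simp add: v w lin g algebra_simps)
  qed
  moreover have "v \<noteq> 0"
  proof
    assume "v = 0"
    then have "pairing h v = 0" by (simp add: lin)
    with D show False by (simp add: v lin h algebra_simps)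
  qed
  moreover from ndep[of 1] have "v \<noteq> w" by simp
  ultimately show ?thesis
    using ndep
    by (auto simp: real_basis_def independent_insert span_singleton insert_commute[of v w])
qed

lemma det_nonzero_if_distinct_lines:
  fixes v w :: "'v::real_vector"
  assumes v: "v = a *\<^sub>R u1 + b *\<^sub>R u2" and w: "w = c *\<^sub>R u1 + d *\<^sub>R u2"
    and "v \<noteq> 0" and ndep: "\<And>k. w \<noteq> k *\<^sub>R v"
  shows "a * d - b * c \<noteq> 0"
proof
  assume D: "a * d - b * c = 0"
  \<comment> \<open>Eliminating \<open>u1\<close>, respectively \<open>u2\<close>, leaves the
    determinant as the only coefficient. If it vanishes, two proportionality relations remain, and
    one of them can be divided by \<open>a\<close> or \<open>b\<close>, which are not both zero
    because \<open>v\<close> is nonzero.\<close>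
  have "a *\<^sub>R w - c *\<^sub>R v = (a * d - b * c) *\<^sub>R u2" "d *\<^sub>R v - b *\<^sub>R w = (a * d - b * c) *\<^sub>R u1"
    unfolding v w by (simp_all add: algebra_simps)
  then have e: "a *\<^sub>R w = c *\<^sub>R v" "b *\<^sub>R w = d *\<^sub>R v" using D by simp_all
  have "w = (c / a) *\<^sub>R v" if "a \<noteq> 0"
    using arg_cong[OF e(1), of "scaleR (1 / a)"] that by simp
  moreover have "w = (d / b) *\<^sub>R v" if "b \<noteq> 0"
    using arg_cong[OF e(2), of "scaleR (1 / b)"] that by simp
  moreover have "a \<noteq> 0 \<or> b \<noteq> 0" using v \<open>v \<noteq> 0\<close> by auto
  ultimately show False using ndep by blast
qed

section \<open>Rays, the angles between them and their dual cones\<close>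

lemma ray_scaleR_pos:
  fixes v :: "'v::real_vector"
  assumes "k > 0"
  shows "{t *\<^sub>R k *\<^sub>R v | t. t \<ge> 0} = {t *\<^sub>R v | t. t \<ge> 0}"
proof (intro equalityI subsetI)
  fix x assume "x \<in> {t *\<^sub>R k *\<^sub>R v | t. t \<ge> 0}"
  then obtain t where "t \<ge> 0" "x = (t * k) *\<^sub>R v" by auto
  then show "x \<in> {t *\<^sub>R v | t. t \<ge> 0}"
    using assms by (auto intro!: exI[of _ "t * k"])
next
  fix x assume "x \<in> {t *\<^sub>R v | t. t \<ge> 0}"
  then obtain t where "t \<ge> 0" "x = (t / k) *\<^sub>R k *\<^sub>R v" using assms by auto
  then show "x \<in> {t *\<^sub>R k *\<^sub>R v | t. t \<ge> 0}"
    using assms by (intro CollectI exI[of _ "t / k"]) simp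
qed

lemma uminus_ray:
  fixes v :: "'v::real_vector"
  shows "uminus ` {t *\<^sub>R v | t. t \<ge> 0} = {t *\<^sub>R (- v) | t. t \<ge> 0}"
  by auto

text \<open>If the second generator were \<open>k\<close> times the first, then \<open>k > 0\<close>
  would make the edges equal, \<open>k < 0\<close> would make them opposite, and
  \<open>k = 0\<close> would contradict that generators are nonzero.\<close>

lemma cone_with_edges_generators:
  fixes \<sigma> :: "'v::real_vector set"
  assumes "cone_with_edges \<sigma> l m"
  obtains v w where "l = {t *\<^sub>R v | t. t \<ge> 0}" "m = {t *\<^sub>R w | t. t \<ge> 0}"
    "v \<noteq> 0" "\<And>k. w \<noteq> k *\<^sub>R v"
proof -
  obtain v w where l: "l = {t *\<^sub>R v | t. t \<ge> 0}" and m: "m = {t *\<^sub>R w | t. t \<ge> 0}"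
    and nz: "v \<noteq> 0" "w \<noteq> 0" and ne: "l \<noteq> m" "l \<noteq> uminus ` m"
    using assms unfolding cone_with_edges_def half_line_def by blast
  have "w \<noteq> k *\<^sub>R v" for k
  proof
    assume w: "w = k *\<^sub>R v"
    consider "k = 0" | "k > 0" | "- k > 0" by linarith
    then show False
    proof cases
      case 1
      then show ?thesis using w nz by simp
    next
      case 2
      then show ?thesis using ne(1) unfolding l m w by (simp only: ray_scaleR_pos)
    next
      case 3
      \<comment> \<open>The opposite of the edge \<open>m\<close> is generated by
        \<open>- w\<close>, which is the positive multiple \<open>- k\<close> of
        \<open>v\<close>.\<close>
      have "uminus ` m = l"
        unfolding l m w uminus_ray using ray_scaleR_pos[OF 3, of v] by simp
      then show ?thesis using ne(2) by simp
    qed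
  qed
  then show thesis using that l m nz by blast
qed

text \<open>The nonnegative combinations form a convex set containing both rays, hence contain the
  hull. Conversely, each of them is a midpoint of a point on one ray and a point on the
  other.\<close>

lemma convex_angle_rays:
  fixes v w :: "'v::real_vector"
  shows "convex_angle {t *\<^sub>R v | t. t \<ge> 0} {t *\<^sub>R w | t. t \<ge> 0}
       = {s *\<^sub>R v + t *\<^sub>R w | s t. s \<ge> 0 \<and> t \<ge> 0}" (is "_ = ?C")
proof
  have "convex ?C"
  proof (rule convexI)
    fix x y and p q :: real
    assume "x \<in> ?C" "y \<in> ?C" and pq: "0 \<le> p" "0 \<le> q"
    then obtain a b c d where *: "x = a *\<^sub>R v + b *\<^sub>R w" "y = c *\<^sub>R v + d *\<^sub>R w"
      and "a \<ge> 0" "b \<ge> 0" "c \<ge> 0" "d \<ge> 0" by blast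
    then have "p *\<^sub>R x + q *\<^sub>R y = (p * a + q * c) *\<^sub>R v + (p * b + q * d) *\<^sub>R w"
      "p * a + q * c \<ge> 0" "p * b + q * d \<ge> 0"
      using pq by (simp_all add: algebra_simps)
    then show "p *\<^sub>R x + q *\<^sub>R y \<in> ?C" by blast
  qed
  moreover have "t *\<^sub>R v \<in> ?C" if "t \<ge> 0" for t
    using that by (intro CollectI exI[of _ t] exI[of _ 0]) simp
  moreover have "t *\<^sub>R w \<in> ?C" if "t \<ge> 0" for t
    using that by (intro CollectI exI[of _ 0] exI[of _ t]) simp
  ultimately show "convex_angle {t *\<^sub>R v | t. t \<ge> 0} {t *\<^sub>R w | t. t \<ge> 0} \<subseteq> ?C"
    unfolding convex_angle_def by (intro hull_minimal) auto
  show "?C \<subseteq> convex_angle {t *\<^sub>R v | t. t \<ge> 0} {t *\<^sub>R w | t. t \<ge> 0}" (is "_ \<subseteq> ?H")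
  proof
    fix x assume "x \<in> ?C"
    then obtain s t where x: "x = s *\<^sub>R v + t *\<^sub>R w" and st: "s \<ge> 0" "t \<ge> 0" by blast
    \<comment> \<open>Doubling compensates for the weights 1/2 of the midpoint.\<close>
    have "(2 * s) *\<^sub>R v \<in> ?H" "(2 * t) *\<^sub>R w \<in> ?H"
      unfolding convex_angle_def using st by (intro hull_inc; force)+
    moreover have "convex ?H" by (simp add: convex_angle_def)
    ultimately have "(1/2) *\<^sub>R (2 * s) *\<^sub>R v + (1/2) *\<^sub>R (2 * t) *\<^sub>R w \<in> ?H"
      by (intro convexD) auto
    then show "x \<in> ?H" by (simp add: x)
  qed
qed

text \<open>By linearity the signs at the two generators decide the signs on the whole
  angle.\<close>

lemma dual_cone_convex_angle_rays:
  "f \<in> dual_cone (convex_angle {t *\<^sub>R v | t. t \<ge> 0} {t *\<^sub>R w | t. t \<ge> 0})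
     \<longleftrightarrow> pairing f v \<ge> 0 \<and> pairing f w \<ge> 0"
proof
  assume *: "f \<in> dual_cone (convex_angle {t *\<^sub>R v | t. t \<ge> 0} {t *\<^sub>R w | t. t \<ge> 0})"
  have "1 *\<^sub>R v + 0 *\<^sub>R w \<in> {s *\<^sub>R v + t *\<^sub>R w | s t. s \<ge> 0 \<and> t \<ge> 0}"
    "0 *\<^sub>R v + 1 *\<^sub>R w \<in> {s *\<^sub>R v + t *\<^sub>R w | s t. s \<ge> 0 \<and> t \<ge> 0}"
    by (metis (mono_tags, lifting) mem_Collect_eq order_refl zero_le_one)+
  then show "pairing f v \<ge> 0 \<and> pairing f w \<ge> 0"
    using * unfolding dual_cone_def convex_angle_rays by auto
qed (auto simp: dual_cone_def convex_angle_rays linear_add[OF linear_pairing]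
      linear_scale[OF linear_pairing])

section \<open>Volume forms and their morphisms to the dual\<close>

lemma volume_form_antisym:
  assumes "volume_form \<omega>"
  shows "\<omega> x y = - \<omega> y x"
proof -
  have bil: "bilinear \<omega>" and alt: "\<And>u. \<omega> u u = 0" using assms by (auto simp: volume_form_def)
  have "\<omega> (x + y) (x + y) = \<omega> x x + \<omega> x y + \<omega> y x + \<omega> y y"
    by (simp add: bilinear_ladd[OF bil] bilinear_radd[OF bil])
  then show ?thesis by (simp add: alt eq_neg_iff_add_eq_0)
qed

lemma pairing_form_morphism:
  assumes "bilinear \<omega>"
  shows "pairing (form_morphism \<omega> u) x = \<omega> u x"
  using assms by (simp add: form_morphism_def pairing_Functional bilinear_def)

lemma linear_form_morphism:
  assumes "bilinear \<omega>"
  shows "linear (form_morphism \<omega>)"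
  by (rule linearI; rule pairing_inject[THEN iffD1])
    (auto simp: fun_eq_iff pairing_form_morphism[OF assms] plus_linear_dual.rep_eq
      scaleR_linear_dual.rep_eq bilinear_ladd[OF assms] bilinear_lmul[OF assms])

text \<open>The values at \<open>u1\<close> and \<open>u2\<close> of the image of
  \<open>a *\<^sub>R u1 + b *\<^sub>R u2\<close> are \<open>- b\<close> and \<open>a\<close>. The
  matrix of this passage is integral with integral inverse, so integral coordinates correspond
  exactly to integral functionals.\<close>

lemma form_morphism_lattice_bij:
  assumes \<omega>: "volume_form \<omega>" and basis: "lattice_basis L u1 u2" and one: "\<omega> u1 u2 = 1"
  shows "bij_betw (form_morphism \<omega>) L (dual_lattice L)"
proof -
  have bil: "bilinear \<omega>" using \<omega> by (simp add: volume_form_def)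
  have B: "real_basis u1 u2" and L: "L = {of_int m *\<^sub>R u1 + of_int n *\<^sub>R u2 | m n. True}"
    using basis by (auto simp: lattice_basis_def)
  have [simp]: "\<omega> u1 u1 = 0" "\<omega> u2 u2 = 0" "\<omega> u2 u1 = - 1"
    using \<omega> volume_form_antisym[OF \<omega>, of u2 u1] one by (simp_all add: volume_form_def)
  note lin = bilinear_ladd[OF bil] bilinear_lmul[OF bil] bilinear_radd[OF bil] bilinear_rmul[OF bil]
  have val: "pairing (form_morphism \<omega> (a *\<^sub>R u1 + b *\<^sub>R u2)) u1 = - b"
    "pairing (form_morphism \<omega> (a *\<^sub>R u1 + b *\<^sub>R u2)) u2 = a" for a b
    by (simp_all add: pairing_form_morphism[OF bil] lin one)
  show ?thesis
  proof (rule bij_betw_imageI)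
    show "inj_on (form_morphism \<omega>) L"
    proof (rule inj_onI)
      fix x y assume eq: "form_morphism \<omega> x = form_morphism \<omega> y"
      obtain a b c d where x: "x = a *\<^sub>R u1 + b *\<^sub>R u2" and y: "y = c *\<^sub>R u1 + d *\<^sub>R u2"
        using real_basis_repr[OF B] by metis
      from eq show "x = y" unfolding x y by (metis val neg_equal_iff_equal)
    qed
    show "form_morphism \<omega> ` L = dual_lattice L"
    proof (intro equalityI subsetI)
      fix f assume "f \<in> form_morphism \<omega> ` L"
      then show "f \<in> dual_lattice L"
        unfolding L by (auto simp: dual_lattice_def pairing_form_morphism[OF bil] lin one)
    next
      fix f assume f: "f \<in> dual_lattice L"
      have "of_int 1 *\<^sub>R u1 + of_int 0 *\<^sub>R u2 \<in> L" "of_int 0 *\<^sub>R u1 + of_int 1 *\<^sub>R u2 \<in> L"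
        unfolding L by blast+
      then obtain m n where mn: "pairing f u1 = of_int m" "pairing f u2 = of_int n"
        using f unfolding dual_lattice_def by simp (metis Ints_cases)
      \<comment> \<open>Inverting \<open>(a, b)\<close> to \<open>(- b, a)\<close> at the values
        \<open>(m, n)\<close> gives the coordinates \<open>(n, - m)\<close>.\<close>
      have "f = form_morphism \<omega> (of_int n *\<^sub>R u1 + of_int (- m) *\<^sub>R u2)"
        by (rule real_basis_functional_eqI[OF B]) (simp_all only: val mn of_int_minus minus_minus)
      moreover have "of_int n *\<^sub>R u1 + of_int (- m) *\<^sub>R u2 \<in> L" unfolding L by blast
      ultimately show "f \<in> form_morphism \<omega> ` L" by blast
    qed
  qed
qed

text \<open>The generators \<open>w\<close> and \<open>- v\<close> of the supplementary cone go to
  \<open>\<omega> w v\<close> times the dual basis of \<open>(v, w)\<close>, and nonnegative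
  combinations of that dual basis make up the dual cone.\<close>

lemma form_morphism_supplementary_cone:
  fixes v w :: "'v::real_vector"
  defines "l \<equiv> {t *\<^sub>R v | t. t \<ge> 0}" and "m \<equiv> {t *\<^sub>R w | t. t \<ge> 0}"
  assumes \<omega>: "volume_form \<omega>" and B: "real_basis v w" and pos: "\<omega> w v > 0"
  shows "form_morphism \<omega> ` supplementary_cone l m = dual_cone (convex_angle l m)"
proof -
  have bil: "bilinear \<omega>" using \<omega> by (simp add: volume_form_def)
  have [simp]: "\<omega> v v = 0" "\<omega> w w = 0" using \<omega> by (simp_all add: volume_form_def)
  have val: "pairing (form_morphism \<omega> (s *\<^sub>R w + t *\<^sub>R (- v))) v = s * \<omega> w v"
    "pairing (form_morphism \<omega> (s *\<^sub>R w + t *\<^sub>R (- v))) w = t * \<omega> w v" for s t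
    by (simp_all add: pairing_form_morphism[OF bil] bilinear_lsub[OF bil] bilinear_lmul[OF bil]
        volume_form_antisym[OF \<omega>, of v w])
  show ?thesis
    unfolding supplementary_cone_def l_def m_def uminus_ray
  proof (intro equalityI subsetI)
    fix f assume "f \<in> form_morphism \<omega> `
      convex_angle {t *\<^sub>R w | t. t \<ge> 0} {t *\<^sub>R (- v) | t. t \<ge> 0}"
    then obtain s t where "s \<ge> 0" "t \<ge> 0" "f = form_morphism \<omega> (s *\<^sub>R w + t *\<^sub>R (- v))"
      unfolding convex_angle_rays by blast
    then show "f \<in> dual_cone (convex_angle {t *\<^sub>R v | t. t \<ge> 0} {t *\<^sub>R w | t. t \<ge> 0})"
      using pos unfolding dual_cone_convex_angle_rays by (simp only: val) simp
  next
    fix f assume "f \<in> dual_cone (convex_angle {t *\<^sub>R v | t. t \<ge> 0} {t *\<^sub>R w | t. t \<ge> 0})"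
    then have "pairing f v / \<omega> w v \<ge> 0" "pairing f w / \<omega> w v \<ge> 0"
      using pos unfolding dual_cone_convex_angle_rays by simp_all
    \<comment> \<open>The coordinates of the preimage are the values of \<open>f\<close> on the
      edges, rescaled by the positive number \<open>\<omega> w v\<close>.\<close>
    moreover have "f = form_morphism \<omega>
        ((pairing f v / \<omega> w v) *\<^sub>R w + (pairing f w / \<omega> w v) *\<^sub>R (- v))"
      using pos by (intro real_basis_functional_eqI[OF B]) (simp_all only: val, simp_all)
    ultimately show "f \<in> form_morphism \<omega> `
        convex_angle {t *\<^sub>R w | t. t \<ge> 0} {t *\<^sub>R (- v) | t. t \<ge> 0}"
      unfolding convex_angle_rays by blast
  qed
qed

section \<open>Oriented lattice bases and the isomorphism of pairs\<close>

theorem proposition5p11: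
  fixes L :: "'v::real_vector set"
    and \<sigma> \<sigma>' l_minus l_plus :: "'v set"
    and \<omega> :: "'v \<Rightarrow> 'v \<Rightarrow> real"
  assumes "rank2_lattice L"
    and "cone_with_edges \<sigma> l_minus l_plus"
    and "\<sigma>' = supplementary_cone l_minus l_plus"
    and "volume_form \<omega>"
    and "\<And>u1 u2. lattice_basis L u1 u2 \<Longrightarrow> opposite_to_edges l_minus l_plus u1 u2 \<Longrightarrow> \<omega> u1 u2 = 1"
  shows "pair_iso (form_morphism \<omega>) (L, \<sigma>') (dual_lattice L, dual_cone \<sigma>)"
proof -
  have bil: "bilinear \<omega>" using assms(4) by (simp add: volume_form_def)
  obtain v w where l: "l_minus = {t *\<^sub>R v | t. t \<ge> 0}" and m: "l_plus = {t *\<^sub>R w | t. t \<ge> 0}"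
    and ndep: "v \<noteq> 0" "\<And>k. w \<noteq> k *\<^sub>R v"
    using cone_with_edges_generators[OF assms(2)] by blast
  \<comment> \<open>A lattice basis is chosen with orientation opposite to that of
    \<open>(v, w)\<close>, so that the normalization of \<omega> applies to it.\<close>
  obtain u1 u2 a b c d where basis: "lattice_basis L u1 u2"
    and v: "v = a *\<^sub>R u1 + b *\<^sub>R u2" and w: "w = c *\<^sub>R u1 + d *\<^sub>R u2"
    and neg: "a * d - b * c < 0"
  proof -
    obtain b1 b2 where basis: "lattice_basis L b1 b2"
      using assms(1) by (auto simp: rank2_lattice_def)
    then have B: "real_basis b1 b2" by (simp add: lattice_basis_def)
    obtain a b where v: "v = a *\<^sub>R b1 + b *\<^sub>R b2" using real_basis_repr[OF B] .
    obtain c d where w: "w = c *\<^sub>R b1 + d *\<^sub>R b2" using real_basis_repr[OF B] .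
    consider "a * d - b * c < 0" | "b * c - a * d < 0"
      using det_nonzero_if_distinct_lines[OF v w ndep] by linarith
    then show thesis
    proof cases
      case 1
      then show ?thesis using that[OF basis v w] by simp
    next
      \<comment> \<open>Exchanging \<open>b1\<close> and \<open>b2\<close> exchanges the columns of
        the coordinate matrix and flips the sign of its determinant.\<close>
      case 2
      then show ?thesis
        using that[OF lattice_basis_commute[OF basis], of b a d c] v w by (simp add: add.commute)
    qed
  qed
  define D where "D = a * d - b * c"
  have D: "D < 0" "D \<noteq> 0" "a * d - b * c \<noteq> 0" using neg by (auto simp: D_def)
  have B: "real_basis u1 u2" using basis by (simp add: lattice_basis_def)
  have Bvw: "real_basis v w" by (rule real_basis_transform[OF B v w D(3)])
  \<comment> \<open>\<open>D\<close> is the determinant of \<open>(v, w)\<close> in the basis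
    \<open>(u1, u2)\<close>, whereas \<open>opposite_orientation\<close> asks for that of
    \<open>(u1, u2)\<close> in the basis \<open>(v, w)\<close>. This is the inverse matrix, with
    determinant \<open>1 / D\<close>, again negative.\<close>
  have "(d / D) * (a / D) - (- b / D) * (- c / D) = 1 / D"
    using D(2) by (simp add: D_def divide_simps)
  then have "(d / D) * (a / D) - (- b / D) * (- c / D) < 0" using D(1) by simp
  then have "opposite_orientation v w u1 u2"
    unfolding opposite_orientation_def
    using B Bvw real_basis_solve[OF v w D(3), folded D_def] by blast
  moreover have "v \<in> l_minus" "w \<in> l_plus" unfolding l m by (auto intro: exI[of _ 1])
  ultimately have one: "\<omega> u1 u2 = 1"
    using assms(5)[OF basis] by (auto simp: opposite_to_edges_def)
  \<comment> \<open>Since \<open>\<omega> u1 u2 = 1\<close>, the form is the determinant in the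
    coordinates of this basis. Reversing the arguments changes the sign of \<open>D\<close>, which
    gives the positivity required for the cones.\<close>
  have "\<omega> w v = - D"
    using assms(4) unfolding v w D_def
    by (simp add: volume_form_def bilinear_ladd bilinear_lmul bilinear_radd bilinear_rmul one
        volume_form_antisym[OF assms(4), of u2 u1])
  then have "form_morphism \<omega> ` \<sigma>' = dual_cone \<sigma>"
    using form_morphism_supplementary_cone[OF assms(4) Bvw] D(1) assms(2,3)
    by (simp add: cone_with_edges_def l m)
  then show ?thesis
    using linear_form_morphism[OF bil] form_morphism_lattice_bij[OF assms(4) basis one]
    by (simp add: pair_iso_def)
qed

end
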